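(* Let $n\ge 1$ and let $v$ be a non-zero element of $\mathbb{C}^n$. Then the complex $n$-dimensional vector space $$\mathcal{E}_v=\{\phi_a:\mathrm{SL}_n(\mathbb{C})\to\mathbb{C}\mid \phi_a(z)=\operatorname{trace}(v^t a z^t),\ a\in\mathbb{C}^n\}$$ is an eigenfamily on the semi-Riemannian Lie group $\mathrm{SL}_n(\mathbb{C})$ such that for all $\phi,\psi\in\mathcal{E}_v$ we have $$\tau(\phi)=-\frac{2(n^2-1)}{n}\cdot\phi,\qquad\kappa(\phi,\psi)=-\frac{2(n-1)}{n}\cdot\phi\cdot\psi.$$
   Context: Elements of $\mathbb{C}^n$ are row vectors, so $v^ta$ is the $n\times n$ matrix $(v_ja_\alpha)_{j\alpha}$. The real Lie group $\mathrm{SL}_n(\mathbb{C})$ carries the left-invariant semi-Riemannian metric $g$ determined by $g(Z,W)=-\operatorname{Re}\operatorname{trace}(ZW)$ on its Lie algebra $\mathfrak{sl}_n(\mathbb{C})=\{Z\in\mathbb{C}^{n\times n}\mid\operatorname{trace}Z=0\}$. For smooth complex-valued functions $\phi,\psi$, $\tau(\phi)=\operatorname{div}(\nabla\phi)$ is the Laplace-Beltrami operator (tension field) and $\kappa(\phi,\psi)=g(\nabla\phi,\nabla\psi)$ is the conformality operator, where $g$ is extended complex-bilinearly to the complexified tangent bundle. A set $\mathcal{E}$ of complex-valued functions is an eigenfamily if there exist $\lambda,\mu\in\mathbb{C}$ with $\tau(\phi)=\lambda\phi$ and $\kappa(\phi,\psi)=\mu\phi\psi$ for all $\phi,\psi\in\mathcal{E}$.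 *)

theory Defs
  imports "HOL-Analysis.Analysis" "HOL-Library.Function_Algebras"
begin

typedef ('n::finite) SL = "{A :: complex^'n^'n. det A = 1}"
  morphisms mat_of Abs_SL
  by (rule exI[of _ "mat 1"]) simp

definition sl :: "(complex^'n^'n) set" where
  "sl = {Z. trace Z = 0}"

text \<open>The tangent space at \<^term>\<open>p\<close> is realised inside the space of matrices, as the image of the
  Lie algebra under left translation by \<^term>\<open>p\<close>; it is regarded as a real vector space.\<close>

definition tangent_space :: "'n::finite SL \<Rightarrow> (complex^'n^'n) set" where
  "tangent_space p = {mat_of p ** Z | Z. Z \<in> sl}"

primrec Ck_on :: "nat \<Rightarrow> 'a::real_normed_vector set \<Rightarrow> ('a \<Rightarrow> 'b::real_normed_vector) \<Rightarrow> bool" where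
  "Ck_on 0 U F \<longleftrightarrow> continuous_on U F"
| "Ck_on (Suc k) U F \<longleftrightarrow> (\<forall>x\<in>U. F differentiable (at x)) \<and>
     (\<forall>w. Ck_on k U (\<lambda>x. frechet_derivative F (at x) w))"

text \<open>Smoothness on the embedded submanifold: locally the restriction of a smooth map on an open
  set of matrices.\<close>

definition smooth :: "('n::finite SL \<Rightarrow> 'b::real_normed_vector) \<Rightarrow> bool" where
  "smooth f \<longleftrightarrow> (\<forall>p. \<exists>U F. open U \<and> mat_of p \<in> U \<and> (\<forall>k. Ck_on k U F) \<and>
     (\<forall>q. mat_of q \<in> U \<longrightarrow> F (mat_of q) = f q))"

text \<open>The differential of \<^term>\<open>f\<close> at \<^term>\<open>p\<close> applied to the tangent vector \<^term>\<open>y\<close>. The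
  derivative is taken within the submanifold, so it depends only on \<^term>\<open>f\<close>; it is uniquely
  determined on the tangent space at \<^term>\<open>p\<close>, and is only ever used there.\<close>

definition differential :: "('n::finite SL \<Rightarrow> 'b::real_normed_vector) \<Rightarrow> 'n SL \<Rightarrow> complex^'n^'n \<Rightarrow> 'b" where
  "differential f p y = frechet_derivative (\<lambda>A. f (Abs_SL A)) (at (mat_of p) within {A. det A = 1}) y"

definition vector_field :: "('n::finite SL \<Rightarrow> complex^'n^'n) \<Rightarrow> bool" where
  "vector_field X \<longleftrightarrow> (\<forall>p. X p \<in> tangent_space p)"

definition smooth_field :: "('n::finite SL \<Rightarrow> complex^'n^'n) \<Rightarrow> bool" where
  "smooth_field X \<longleftrightarrow> vector_field X \<and> smooth X"

text \<open>The Lie bracket of vector fields, computed in the ambient vector space of matrices.\<close>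

definition bracket ::
  "('n::finite SL \<Rightarrow> complex^'n^'n) \<Rightarrow> ('n SL \<Rightarrow> complex^'n^'n) \<Rightarrow> 'n SL \<Rightarrow> complex^'n^'n" where
  "bracket X Y p = differential Y p (X p) - differential X p (Y p)"

definition left_inv_field :: "'n::finite SL \<Rightarrow> complex^'n^'n \<Rightarrow> 'n SL \<Rightarrow> complex^'n^'n" where
  "left_inv_field p y q = mat_of q ** (matrix_inv (mat_of p) ** y)"

definition metric :: "'n::finite SL \<Rightarrow> complex^'n^'n \<Rightarrow> complex^'n^'n \<Rightarrow> real" where
  "metric p y w = - Re (trace ((matrix_inv (mat_of p) ** y) ** (matrix_inv (mat_of p) ** w)))"

text \<open>Smoothness of \<^term>\<open>D X Y\<close> need not be required: the
  conditions determine \<^term>\<open>D X Y\<close> for smooth fields through the Koszul formula.\<close>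

definition is_levi_civita ::
  "(('n::finite SL \<Rightarrow> complex^'n^'n) \<Rightarrow> ('n SL \<Rightarrow> complex^'n^'n) \<Rightarrow> 'n SL \<Rightarrow> complex^'n^'n) \<Rightarrow> bool" where
  "is_levi_civita D \<longleftrightarrow>
     (\<forall>X Y. smooth_field X \<longrightarrow> smooth_field Y \<longrightarrow> vector_field (D X Y)) \<and>
     (\<forall>X X' Y p. smooth_field X \<longrightarrow> smooth_field X' \<longrightarrow> smooth_field Y \<longrightarrow>
        D (\<lambda>q. X q + X' q) Y p = D X Y p + D X' Y p) \<and>
     (\<forall>(f :: 'n SL \<Rightarrow> real) X Y p. smooth f \<longrightarrow> smooth_field X \<longrightarrow> smooth_field Y \<longrightarrow>
        D (\<lambda>q. f q *\<^sub>R X q) Y p = f p *\<^sub>R D X Y p) \<and>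
     (\<forall>X Y Y' p. smooth_field X \<longrightarrow> smooth_field Y \<longrightarrow> smooth_field Y' \<longrightarrow>
        D X (\<lambda>q. Y q + Y' q) p = D X Y p + D X Y' p) \<and>
     (\<forall>(f :: 'n SL \<Rightarrow> real) X Y p. smooth f \<longrightarrow> smooth_field X \<longrightarrow> smooth_field Y \<longrightarrow>
        D X (\<lambda>q. f q *\<^sub>R Y q) p = differential f p (X p) *\<^sub>R Y p + f p *\<^sub>R D X Y p) \<and>
     (\<forall>X Y p. smooth_field X \<longrightarrow> smooth_field Y \<longrightarrow> D X Y p - D Y X p = bracket X Y p) \<and>
     (\<forall>X Y Z p. smooth_field X \<longrightarrow> smooth_field Y \<longrightarrow> smooth_field Z \<longrightarrow>
        differential (\<lambda>q. metric q (Y q) (Z q)) p (X p) =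
          metric p (D X Y p) (Z p) + metric p (Y p) (D X Z p))"

definition levi_civita ::
  "('n::finite SL \<Rightarrow> complex^'n^'n) \<Rightarrow> ('n SL \<Rightarrow> complex^'n^'n) \<Rightarrow> 'n SL \<Rightarrow> complex^'n^'n" where
  "levi_civita = (SOME D. is_levi_civita D)"

text \<open>For a linear map of the finite-dimensional real subspace \<^term>\<open>S\<close> into itself, the value
  does not depend on the chosen basis.\<close>

definition trace_on :: "'a::real_vector set \<Rightarrow> ('a \<Rightarrow> 'a) \<Rightarrow> real" where
  "trace_on S L = (let B = (SOME B. independent B \<and> span B = S)
                   in \<Sum>b\<in>B. representation B (L b) b)"

definition grad :: "('n::finite SL \<Rightarrow> real) \<Rightarrow> 'n SL \<Rightarrow> complex^'n^'n" where
  "grad u p = (THE w. w \<in> tangent_space p \<and> (\<forall>y\<in>tangent_space p. metric p w y = differential u p y))"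

text \<open>The divergence is the trace of the endomorphism sending a tangent vector \<^term>\<open>y\<close> to the
  covariant derivative of \<^term>\<open>X\<close> in direction \<^term>\<open>y\<close>. The connection is tensorial in the
  direction, so \<^term>\<open>y\<close> may be extended to any smooth field, here to a left-invariant one.\<close>

definition divergence :: "('n::finite SL \<Rightarrow> complex^'n^'n) \<Rightarrow> 'n SL \<Rightarrow> real" where
  "divergence X p = trace_on (tangent_space p) (\<lambda>y. levi_civita (left_inv_field p y) X p)"

text \<open>Elements of the complexified tangent space are formal sums \<open>x + i y\<close> of tangent vectors,
  represented as pairs \<open>(x, y)\<close>. (Multiplication of matrices by the scalar \<open>i\<close> is a different
  operation, under which the tangent space itself is stable.)\<close>

definition cmetric ::
  "'n::finite SL \<Rightarrow> (complex^'n^'n) \<times> (complex^'n^'n) \<Rightarrow> (complex^'n^'n) \<times> (complex^'n^'n) \<Rightarrow> complex" where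
  "cmetric p s t =
     Complex (metric p (fst s) (fst t) - metric p (snd s) (snd t))
             (metric p (fst s) (snd t) + metric p (snd s) (fst t))"

definition cgrad :: "('n::finite SL \<Rightarrow> complex) \<Rightarrow> 'n SL \<Rightarrow> (complex^'n^'n) \<times> (complex^'n^'n)" where
  "cgrad \<phi> p = (grad (\<lambda>q. Re (\<phi> q)) p, grad (\<lambda>q. Im (\<phi> q)) p)"

definition cdivergence :: "('n::finite SL \<Rightarrow> (complex^'n^'n) \<times> (complex^'n^'n)) \<Rightarrow> 'n SL \<Rightarrow> complex" where
  "cdivergence X p = Complex (divergence (\<lambda>q. fst (X q)) p) (divergence (\<lambda>q. snd (X q)) p)"

definition tau :: "('n::finite SL \<Rightarrow> complex) \<Rightarrow> 'n SL \<Rightarrow> complex" where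
  "tau \<phi> = cdivergence (cgrad \<phi>)"

definition kappa :: "('n::finite SL \<Rightarrow> complex) \<Rightarrow> ('n SL \<Rightarrow> complex) \<Rightarrow> 'n SL \<Rightarrow> complex" where
  "kappa \<phi> \<psi> p = cmetric p (cgrad \<phi> p) (cgrad \<psi> p)"

definition eigenfamily :: "('n::finite SL \<Rightarrow> complex) set \<Rightarrow> bool" where
  "eigenfamily E \<longleftrightarrow> (\<forall>\<phi>\<in>E. smooth \<phi>) \<and>
     (\<exists>lam mu. \<forall>\<phi>\<in>E. \<forall>\<psi>\<in>E. \<forall>p. tau \<phi> p = lam * \<phi> p \<and> kappa \<phi> \<psi> p = mu * \<phi> p * \<psi> p)"

definition row_outer :: "complex^'n \<Rightarrow> complex^'n \<Rightarrow> complex^'n^'n" where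
  "row_outer v a = (\<chi> j \<alpha>. v $ j * a $ \<alpha>)"

definition phi :: "complex^'n \<Rightarrow> complex^'n \<Rightarrow> 'n::finite SL \<Rightarrow> complex" where
  "phi v a z = trace (row_outer v a ** transpose (mat_of z))"

definition E_fam :: "complex^'n \<Rightarrow> ('n::finite SL \<Rightarrow> complex) set" where
  "E_fam v = {phi v a | a. True}"

definition fun_scale :: "complex \<Rightarrow> ('x \<Rightarrow> complex) \<Rightarrow> 'x \<Rightarrow> complex" where
  "fun_scale c \<phi> = (\<lambda>z. c * \<phi> z)"

lemma vector_space_fun_scale: "vector_space fun_scale"
  by unfold_locales (auto simp: fun_scale_def fun_eq_iff algebra_simps)

end

theory Submission
  imports Defs
begin

text \<open>All functions involved have the form \<open>q \<mapsto> trace (N q)\<close>, with \<open>N = a\<^sup>t v\<close> for \<open>\<phi>\<^sub>a\<close>.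
  The gradient of the real part of such a function at \<open>p\<close> is
  \<open>(trace (N p)/n) p - p N p\<close>, and its imaginary part is the real part belonging to \<open>-i N\<close>.
  As the metric is bi-invariant, the Levi-Civita connection is
  \<open>D\<^sub>X Y = dY(X) - (X p\<^bsup>-1\<^esup> Y + Y p\<^bsup>-1\<^esup> X)/2\<close>. Precomposing the endomorphism whose trace is the
  divergence with the projection \<open>y \<mapsto> y - (trace (p\<^bsup>-1\<^esup> y)/n) p\<close> of all matrices onto the tangent
  space gives a sum of maps \<open>y \<mapsto> Q y R\<close> and \<open>y \<mapsto> trace (Q y) R\<close>, with complex traces
  \<open>trace Q trace R\<close> and \<open>trace (Q R)\<close>. For \<open>\<kappa>\<close>, the rank-one form of \<open>N\<close> gives
  \<open>trace (N p N' p) = trace (N p) trace (N' p)\<close>.\<close>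

subsection \<open>Matrices and traces\<close>

lemma mat_mult_eq: "mat c ** A = (\<chi> i j. c * A $ i $ j)" for A :: "'a::semiring_1^'m^'n"
  by (simp add: matrix_matrix_mult_def mat_def vec_eq_iff if_distrib[of "\<lambda>x. x * _"] cong: if_cong)

lemma mult_mat_commute: "A ** mat c = mat c ** A" for A :: "'a::comm_semiring_1^'n^'n"
  by (simp add: mat_mult_eq)
     (simp add: matrix_matrix_mult_def mat_def vec_eq_iff if_distrib[of "\<lambda>x. _ * x"] mult.commute
         cong: if_cong)

lemma mult_mat_left_commute: "A ** (mat c ** B) = mat c ** (A ** B)"
    for A B :: "'a::comm_semiring_1^'n^'n"
  by (metis matrix_mul_assoc mult_mat_commute)

lemma trace_mat_mult: "trace (mat c ** A) = c * trace A" for A :: "'a::comm_semiring_1^'n^'n"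
  by (simp add: mat_mult_eq trace_def sum_distrib_left)

lemma trace_mat: "trace (mat c :: 'a::semiring_1^'n^'n) = of_nat CARD('n) * c"
  by (simp add: trace_def mat_def)

lemma matrix_add_rdistrib: "(B + C) ** A = B ** A + C ** A" for A :: "'a::semiring_1^'n^'m"
  by (simp add: matrix_matrix_mult_def vec_eq_iff sum.distrib algebra_simps)

lemma matrix_diff_ldistrib: "A ** (B - C) = A ** B - A ** C" for A :: "'a::ring_1^'n^'m"
  by (simp add: matrix_matrix_mult_def vec_eq_iff sum_subtractf algebra_simps)

lemma matrix_diff_rdistrib: "(B - C) ** A = B ** A - C ** A" for A :: "'a::ring_1^'n^'m"
  by (simp add: matrix_matrix_mult_def vec_eq_iff sum_subtractf algebra_simps)

lemma matrix_mult_minus_right: "A ** (- B) = - (A ** B)" for A :: "'a::ring_1^'n^'m"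
  by (simp add: matrix_matrix_mult_def vec_eq_iff sum_negf)

lemma matrix_mult_minus_left: "(- B) ** A = - (B ** A)" for A :: "'a::ring_1^'n^'m"
  by (simp add: matrix_matrix_mult_def vec_eq_iff sum_negf)

lemma matrix_mult_scaleR_right: "A ** (r *\<^sub>R B) = r *\<^sub>R (A ** B)"
    for A :: "'a::real_algebra_1^'n^'m"
  by (simp add: matrix_matrix_mult_def vec_eq_iff scaleR_sum_right)

lemma matrix_mult_scaleR_left: "(r *\<^sub>R B) ** A = r *\<^sub>R (B ** A)" for A :: "'a::real_algebra_1^'n^'m"
  by (simp add: matrix_matrix_mult_def vec_eq_iff scaleR_sum_right)

lemma trace_scaleR: "trace (r *\<^sub>R A) = r *\<^sub>R trace A" for A :: "'a::real_algebra_1^'n^'n"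
  by (simp add: trace_def scaleR_sum_right)

lemma trace_minus: "trace (- A) = - trace A" for A :: "'a::ring_1^'n^'n"
  by (simp add: trace_def sum_negf)

lemma matrix_mult_zero [simp]: "A ** 0 = 0" "0 ** A = 0" for A :: "'a::semiring_1^'n^'m"
  by (simp_all add: matrix_matrix_mult_def vec_eq_iff)

lemmas matrix_distribs = matrix_add_ldistrib matrix_add_rdistrib matrix_diff_ldistrib
    matrix_diff_rdistrib
  matrix_mult_minus_right matrix_mult_minus_left matrix_mult_scaleR_right matrix_mult_scaleR_left
lemmas trace_linears = trace_add trace_sub trace_minus trace_scaleR trace_mat_mult trace_mat

lemma bounded_bilinear_matrix_mult: "bounded_bilinear ((**) :: complex^'n^'n \<Rightarrow> complex^'n^'n \<Rightarrow> _)"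
  by (simp add: bilinear_conv_bounded_bilinear[symmetric] bilinear_def linear_iff matrix_distribs)

lemmas has_derivative_matrix_mult [derivative_intros] =
  bounded_bilinear.FDERIV[OF bounded_bilinear_matrix_mult]

lemma bounded_linear_trace: "bounded_linear (trace :: complex^'n^'n \<Rightarrow> complex)"
  by (simp add: linear_conv_bounded_linear[symmetric] linear_iff trace_linears)

lemma bounded_linear_mat: "bounded_linear (mat :: complex \<Rightarrow> complex^'n^'n)"
  by (simp add: linear_conv_bounded_linear[symmetric] linear_iff vec_eq_iff mat_def)

lemmas has_derivative_trace [derivative_intros]
    = bounded_linear.has_derivative[OF bounded_linear_trace]
lemmas has_derivative_mat [derivative_intros] = bounded_linear.has_derivative[OF bounded_linear_mat]

section \<open>Real traces of linear maps on matrix space\<close>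

lemma sum_Basis_matrix:
  "(\<Sum>e\<in>(Basis :: (complex^'n^'n) set). f e :: 'b::comm_monoid_add) =
     (\<Sum>i\<in>UNIV. \<Sum>j\<in>UNIV. f (axis i (axis j 1)) + f (axis i (axis j \<i>)))"
proof -
  have vec: "(\<Sum>e\<in>(Basis :: ('a::euclidean_space^'n) set). g e) = (\<Sum>i\<in>UNIV. \<Sum>u\<in>Basis. g (axis i u))"
    for g :: "'a::euclidean_space^'n \<Rightarrow> 'b::comm_monoid_add"
  proof -
    have "Basis = (\<lambda>(i, u). axis i u) ` (UNIV \<times> (Basis :: 'a set))"
      by (auto simp: Basis_vec_def)
    moreover have "inj_on (\<lambda>(i::'n, u). axis i u) (UNIV \<times> (Basis :: 'a set))"
      by (auto simp: inj_on_def axis_eq_axis)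
    ultimately have "(\<Sum>e\<in>Basis. g e) = sum (g \<circ> (\<lambda>(i, u). axis i u)) (UNIV \<times> Basis)"
      by (metis sum.reindex)
    also have "\<dots> = (\<Sum>(i, u)\<in>UNIV \<times> Basis. g (axis i u))"
      by (simp add: case_prod_unfold comp_def)
    finally have "(\<Sum>e\<in>Basis. g e) = (\<Sum>(i, u)\<in>UNIV \<times> Basis. g (axis i u))" .
    then show ?thesis by (simp only: sum.cartesian_product)
  qed
  show ?thesis by (simp add: vec Basis_complex_def)
qed

text \<open>The real basis consists of the matrix units and their multiples by the imaginary unit.
  The two elements at position \<open>(i, j)\<close> each contribute
  \<open>Re (Q $ i $ i * R $ j $ j)\<close>, which is the usual factor 2 between the real trace of a
  complex-linear map and the real part of its complex trace.\<close>

lemma sum_Basis_sandwich: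
  fixes Q R :: "complex^'n^'n"
  shows "(\<Sum>e\<in>Basis. (Q ** e ** R) \<bullet> e) = 2 * Re (trace Q * trace R)"
proof -
  have entry: "(Q ** axis i (axis j u) ** R) $ i $ j = Q $ i $ i * u * R $ j $ j" for i j u
  proof -
    have "(Q ** axis i (axis j u)) $ i $ l = (if l = j then Q $ i $ i * u else 0)" for l
      by (simp add: matrix_matrix_mult_def axis_def if_distrib[of "\<lambda>x. _ * x"]
          if_distrib[of "\<lambda>x. x $ _"] cong: if_cong)
    then show ?thesis
      by (simp add: matrix_matrix_mult_def[of _ R] if_distrib[of "\<lambda>x. x * _"] cong: if_cong)
  qed
  have "(\<Sum>e\<in>Basis. (Q ** e ** R) \<bullet> e) = (\<Sum>i\<in>UNIV. \<Sum>j\<in>UNIV. 2 * Re (Q $ i $ i * R $ j $ j))"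
    by (simp add: sum_Basis_matrix inner_axis entry inner_complex_def algebra_simps)
  also have "\<dots> = 2 * Re (\<Sum>i\<in>UNIV. \<Sum>j\<in>UNIV. Q $ i $ i * R $ j $ j)"
    by (simp only: Re_sum sum_distrib_left)
  also have "\<dots> = 2 * Re (trace Q * trace R)"
    by (simp only: trace_def sum_product)
  finally show ?thesis .
qed

text \<open>As in \<open>sum_Basis_sandwich\<close>, both basis elements at one position contribute
  equally. Here the complex-linear map has rank at most one, so its complex trace is the functional
  evaluated at \<open>R\<close>.\<close>

lemma sum_Basis_rank_one:
  fixes Q R :: "complex^'n^'n"
  shows "(\<Sum>e\<in>Basis. (mat (trace (Q ** e)) ** R) \<bullet> e) = 2 * Re (trace (Q ** R))"
proof -
  have tr: "trace (Q ** axis i (axis j u)) = Q $ j $ i * u" for i j u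
    by (simp add: trace_def matrix_matrix_mult_def axis_def if_distrib[of "\<lambda>x. _ * x"]
        if_distrib[of "\<lambda>x. x $ _"] cong: if_cong)
  have "(\<Sum>e\<in>Basis. (mat (trace (Q ** e)) ** R) \<bullet> e)
      = (\<Sum>i\<in>UNIV. \<Sum>j\<in>UNIV. 2 * Re (Q $ j $ i * R $ i $ j))"
    by (simp add: sum_Basis_matrix inner_axis tr mat_mult_eq inner_complex_def algebra_simps)
  also have "\<dots> = 2 * Re (trace (Q ** R))"
    by (subst sum.swap) (simp add: trace_def matrix_matrix_mult_def sum_distrib_left)
  finally show ?thesis .
qed

text \<open>A map of the whole space with image in \<open>S\<close> has the same trace as its
  restriction to \<open>S\<close>. This replaces the arbitrarily chosen basis of \<open>S\<close> by
  the standard one: expand each \<open>T e\<close> in the chosen basis \<open>B\<close>, exchange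
  the sums, and reassemble \<open>b\<close> from its coordinates by linearity.\<close>

lemma trace_on_eq_sum_Basis:
  fixes S :: "'a::euclidean_space set"
  assumes S: "subspace S" and T: "linear T" and TS: "range T \<subseteq> S" and LT: "\<And>y. y \<in> S \<Longrightarrow> L y = T y"
  shows "trace_on S L = (\<Sum>e\<in>Basis. T e \<bullet> e)"
proof -
  define B where "B = (SOME B. independent B \<and> span B = S)"
  have "\<exists>B. independent B \<and> span B = S"
    using basis_exists[of S] S by (metis span_subspace)
  then have "independent B \<and> span B = S"
    unfolding B_def by (rule someI_ex)
  then have B: "independent B" "span B = S" by auto
  have fin: "finite B" using B(1) by (rule finiteI_independent)
  have inS: "T x \<in> span B" for x using TS B(2) by auto
  have "(\<Sum>e\<in>Basis. T e \<bullet> e) = (\<Sum>e\<in>Basis. (\<Sum>b\<in>B. representation B (T e) b *\<^sub>R b) \<bullet> e)"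
    by (intro sum.cong refl) (metis sum_representation_eq[OF B(1) inS fin order_refl])
  also have "\<dots> = (\<Sum>b\<in>B. \<Sum>e\<in>Basis. (b \<bullet> e) * representation B (T e) b)"
    by (subst sum.swap) (simp only: inner_sum_left inner_scaleR_left mult.commute)
  also have "\<dots> = (\<Sum>b\<in>B. representation B (T b) b)"
  proof (rule sum.cong[OF refl])
    fix b assume "b \<in> B"
    have "T b = T (\<Sum>e\<in>Basis. (b \<bullet> e) *\<^sub>R e)" by (simp only: euclidean_representation)
    also have "\<dots> = (\<Sum>e\<in>Basis. (b \<bullet> e) *\<^sub>R T e)" by (simp only: linear_sum[OF T] linear_scale[OF T])
    finally show "(\<Sum>e\<in>Basis. (b \<bullet> e) * representation B (T e) b) = representation B (T b) b"
      using inS by (simp only: representation_sum[OF B(1)] representation_scale[OF B(1)] span_scale)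
  qed
  also have "\<dots> = (\<Sum>b\<in>B. representation B (L b) b)"
  proof (rule sum.cong[OF refl])
    fix b assume "b \<in> B"
    then have "b \<in> S" using span_base B(2) by blast
    then show "representation B (T b) b = representation B (L b) b" by (simp only: LT)
  qed
  finally show ?thesis by (simp add: trace_on_def B_def[symmetric] Let_def)
qed

section \<open>Derivatives of the inverse and of the determinant\<close>

lemma matrix_inv_det_1:
  fixes A :: "complex^'n^'n" assumes "det A = 1"
  shows "matrix_inv A ** A = mat 1" "A ** matrix_inv A = mat 1"
proof -
  have "invertible A" using assms by (simp add: invertible_det_nz)
  then have "\<exists>A'. A ** A' = mat 1 \<and> A' ** A = mat 1" by (simp add: invertible_def)
  from someI_ex[OF this] show "matrix_inv A ** A = mat 1" "A ** matrix_inv A = mat 1"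
    by (auto simp: matrix_inv_def)
qed

lemma continuous_on_det: "continuous_on U (\<lambda>x. det (f x))"
  if "\<And>i j. continuous_on U (\<lambda>x. f x $ i $ j)" for f :: "'a::topological_space \<Rightarrow> complex^'n^'n"
  unfolding det_def by (intro continuous_intros that)

text \<open>Cramer's rule for \<open>A *v x = axis l 1\<close> gives column \<open>l\<close> of the
  inverse. The entries become polynomials in those of \<open>A\<close>, which yields continuity on
  the group.\<close>

lemma matrix_inv_cofactor:
  fixes A :: "complex^'n^'n" assumes "det A = 1"
  shows "matrix_inv A = (\<chi> k l. det (\<chi> i j. if j = k then (if i = l then 1 else 0) else A $ i $ j))"
proof -
  have "A *v (matrix_inv A *v axis l 1) = axis l 1" for l
    by (simp add: matrix_vector_mul_assoc matrix_inv_det_1[OF assms])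
  then have "matrix_inv A *v axis l 1 = (\<chi> k. det (\<chi> i j.
      if j = k then (axis l 1 :: complex^'n) $ i else A $ i $ j))" for l
    using cramer[of A] assms by simp
  then have "(matrix_inv A *v axis l 1) $ k = det (\<chi> i j.
      if j = k then (if i = l then 1 else 0) else A $ i $ j)" for k l
    by (simp add: axis_def cong: if_cong)
  moreover have "(matrix_inv A *v axis l 1) $ k = matrix_inv A $ k $ l" for k l
    by (simp add: matrix_vector_mult_def axis_def if_distrib[of "\<lambda>x. _ * x"] cong: if_cong)
  ultimately show ?thesis by (simp add: vec_eq_iff)
qed

lemma continuous_on_matrix_inv: "continuous_on {A :: complex^'n^'n. det A = 1} matrix_inv"
proof -
  have "continuous_on {A :: complex^'n^'n. det A = 1}
          (\<lambda>A. \<chi> k l. det (\<chi> i j. if j = k then (if i = l then 1 else 0) else A $ i $ j))"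
  proof (intro continuous_on_vec_lambda continuous_on_det)
    fix k l i j :: 'n
    show "continuous_on {A :: complex^'n^'n. det A = 1}
       (\<lambda>A. (\<chi> i j. if j = k then (if i = l then 1 else 0) else A $ i $ j) $ i $ j)"
      by (cases "j = k") (auto intro!: continuous_intros)
  qed
  then show ?thesis
    by (rule continuous_on_eq) (simp add: matrix_inv_cofactor)
qed

text \<open>By the identity \<open>id\<close>, the remainder is the product of
  \<open>?m - matrix_inv B\<close>, \<open>B - A\<close> and \<open>?m\<close>. Divided by
  \<open>norm (B - A)\<close>, it is at most a constant times
  \<open>norm (?m - matrix_inv B)\<close>, which tends to 0 by continuity.\<close>

lemma has_derivative_matrix_inv:
  fixes A :: "complex^'n^'n" assumes A: "det A = 1"
  shows "(matrix_inv has_derivative (\<lambda>W. - (matrix_inv A ** W ** matrix_inv A)))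
      (at A within {A. det A = 1})"
proof -
  let ?S = "{A :: complex^'n^'n. det A = 1}"
  let ?m = "matrix_inv A"
  obtain K where K: "0 < K" "\<And>(X :: complex^'n^'n) (Y :: complex^'n^'n). norm (X ** Y) \<le> norm X
      * norm Y * K"
    using bounded_bilinear.pos_bounded[OF bounded_bilinear_matrix_mult] by metis
  have lin: "bounded_linear (\<lambda>W. - (?m ** W ** ?m))"
    by (simp add: linear_conv_bounded_linear[symmetric] linear_iff matrix_distribs)
  have id: "matrix_inv B - ?m - - (?m ** (B - A) ** ?m) = (?m - matrix_inv B) ** (B - A) ** ?m"
      if "B \<in> ?S" for B
  proof -
    have "?m ** A ** ?m = ?m" "matrix_inv B ** B ** ?m = ?m"
      using that by (simp_all add: matrix_inv_det_1 A)
    moreover have "matrix_inv B ** A ** ?m = matrix_inv B"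
      by (simp add: matrix_mul_assoc[symmetric] matrix_inv_det_1[OF A])
    ultimately show ?thesis by (simp add: matrix_distribs)
  qed
  have "norm (matrix_inv B - ?m - - (?m ** (B - A) ** ?m)) / norm (B - A) \<le>
      norm (?m - matrix_inv B) * (K * norm ?m * K)" if B: "B \<in> ?S" for B
  proof (cases "B = A")
    case False
    have "norm ((?m - matrix_inv B) ** (B - A) ** ?m) \<le> norm ((?m - matrix_inv B) ** (B - A))
        * norm ?m * K"
      by (rule K)
    also have "\<dots> \<le> (norm (?m - matrix_inv B) * norm (B - A) * K) * norm ?m * K"
      using K by (intro mult_right_mono) auto
    finally show ?thesis unfolding id[OF B] using False by (simp add: field_simps)
  qed simp
  then have ev: "\<forall>\<^sub>F B in at A within ?S. norm (norm (matrix_inv B - ?m - - (?m ** (B - A)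
      ** ?m)) / norm (B - A)) \<le>
      norm (?m - matrix_inv B) * (K * norm ?m * K)"
    by (auto simp: eventually_at_filter)
  have "(matrix_inv \<longlongrightarrow> ?m) (at A within ?S)"
    using continuous_on_matrix_inv A by (auto simp: continuous_on_def)
  then have "((\<lambda>B. norm (?m - matrix_inv B) * (K * norm ?m * K)) \<longlongrightarrow> norm (?m - ?m) * (K * norm ?m
      * K)) (at A within ?S)"
    by (intro tendsto_intros)
  then have "((\<lambda>B. norm (?m - matrix_inv B) * (K * norm ?m * K)) \<longlongrightarrow> 0) (at A within ?S)" by simp
  from Lim_null_comparison[OF ev this] lin show ?thesis
    by (simp add: has_derivative_iff_norm)
qed

text \<open>Differentiate the Leibniz sum at 0. A permutation other than \<open>id\<close> moves at
  least two indices, so after one factor is differentiated an off-diagonal zero of the identity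
  matrix remains; only the diagonal product survives.\<close>

lemma has_vector_derivative_det_mat_1_plus:
  fixes Z :: "complex^'n^'n"
  shows "((\<lambda>t. det (mat 1 + t *\<^sub>R Z)) has_vector_derivative trace Z) (at 0)"
proof -
  have "((\<lambda>t. det (mat 1 + t *\<^sub>R Z)) has_derivative
     (\<lambda>t. \<Sum>\<pi>\<in>{\<pi>. \<pi> permutes UNIV}. of_int (sign \<pi>) *
        (\<Sum>i\<in>UNIV. (t *\<^sub>R Z $ i $ \<pi> i) * (\<Prod>j\<in>UNIV - {i}. mat 1 $ j $ \<pi> j)))) (at 0)"
    unfolding det_def
    by (auto intro!: derivative_eq_intros sum.cong simp: fun_eq_iff)
  moreover have "(\<Sum>\<pi>\<in>{\<pi>. \<pi> permutes UNIV}. of_int (sign \<pi>) *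
        (\<Sum>i\<in>UNIV. (t *\<^sub>R Z $ i $ \<pi> i) * (\<Prod>j\<in>UNIV - {i}. mat 1 $ j $ \<pi> j))) = t *\<^sub>R trace Z" for t
  proof -
    have zero: "(\<Prod>j\<in>UNIV - {i}. (mat 1 :: complex^'n^'n) $ j $ \<pi> j) = 0"
        if \<pi>: "\<pi> permutes (UNIV :: 'n set)" "\<pi> \<noteq> id" for \<pi> i
    proof -
      have "\<exists>j. j \<noteq> i \<and> \<pi> j \<noteq> j"
      proof (rule ccontr)
        assume "\<not> ?thesis"
        then have fixed: "\<And>j. j \<noteq> i \<Longrightarrow> \<pi> j = j" by auto
        have "\<pi> i = i" using fixed[of "\<pi> i"] \<pi>(1) permutes_inj by (metis injD)
        with fixed have "\<pi> x = x" for x by (cases "x = i") auto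
        then have "\<pi> = id" by (simp add: fun_eq_iff)
        with \<pi> show False by simp
      qed
      then show ?thesis by (force simp: mat_def)
    qed
    have "(\<Sum>\<pi>\<in>{\<pi>. \<pi> permutes UNIV}. of_int (sign \<pi>) *
        (\<Sum>i\<in>UNIV. (t *\<^sub>R Z $ i $ \<pi> i) * (\<Prod>j\<in>UNIV - {i}. mat 1 $ j $ \<pi> j))) =
      (\<Sum>\<pi>\<in>{id}. of_int (sign \<pi>) *
        (\<Sum>i\<in>UNIV. (t *\<^sub>R Z $ i $ \<pi> i) * (\<Prod>j\<in>UNIV - {i}. mat 1 $ j $ \<pi> j)))"
      by (rule sum.mono_neutral_right) (auto simp: finite_permutations permutes_id zero)
    also have "\<dots> = t *\<^sub>R trace Z"
      by (simp add: sign_id mat_def trace_def scaleR_sum_right)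
    finally show ?thesis .
  qed
  ultimately show ?thesis by (simp add: has_vector_derivative_def)
qed

subsection \<open>The Levi-Civita connection\<close>

lemma det_mat_of [simp]: "det (mat_of p) = 1"
  using mat_of[of p] by simp

lemma mat_of_Abs_SL: "det A = 1 \<Longrightarrow> mat_of (Abs_SL A) = A"
  by (simp add: Abs_SL_inverse)

lemmas matrix_inv_mat_of [simp] = matrix_inv_det_1[OF det_mat_of]

lemma mult_matrix_inv_cancel [simp]:
  "X ** mat_of p ** matrix_inv (mat_of p) = X" "X ** matrix_inv (mat_of p) ** mat_of p = X"
  by (simp_all flip: matrix_mul_assoc)

section \<open>Tangent vectors and differentials\<close>

lemma tangent_space_iff: "y \<in> tangent_space p \<longleftrightarrow> trace (matrix_inv (mat_of p) ** y) = 0"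
proof
  assume "trace (matrix_inv (mat_of p) ** y) = 0"
  moreover have "y = mat_of p ** (matrix_inv (mat_of p) ** y)"
    by (simp add: matrix_mul_assoc)
  ultimately show "y \<in> tangent_space p" unfolding tangent_space_def sl_def by blast
qed (auto simp: tangent_space_def sl_def matrix_mul_assoc)

lemma subspace_tangent_space: "subspace (tangent_space p)"
  by (auto simp: subspace_def tangent_space_iff matrix_distribs trace_linears) (simp add: trace_def)

text \<open>The curve is \<open>p (I + t Z)\<close>, with one row of \<open>I + t Z\<close> divided by \<open>det (I + t Z)\<close>; as
  \<open>trace Z = 0\<close>, this does not change its velocity at \<open>0\<close>.\<close>

lemma tangent_vector_curve:
  assumes "y \<in> tangent_space p"
  obtains c where "c 0 = mat_of p" "(c has_vector_derivative y) (at 0)"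
    "eventually (\<lambda>t. det (c t) = 1) (nhds (0::real))"
proof -
  obtain Z where Z: "trace Z = 0" "y = mat_of p ** Z"
    using assms by (auto simp: tangent_space_def sl_def)
  \<comment> \<open>Any index serves; \<open>i0\<close> is the row that is rescaled to restore
    determinant 1.\<close>
  obtain i0 :: 'a where True by simp
  define E :: "complex^'a^'a" where "E = (\<chi> i j. if i = i0 \<and> j = i0 then 1 else 0)"
  define f where "f t = det (mat 1 + t *\<^sub>R Z)" for t :: real
  define c where "c t = mat_of p ** (mat 1 + mat (inverse (f t) - 1) ** E) ** (mat 1 + t *\<^sub>R Z)"
      for t
  have f0: "f 0 = 1" by (simp add: f_def)
  have f': "(f has_derivative (\<lambda>t. 0)) (at 0)"
    using has_vector_derivative_det_mat_1_plus[of Z] Z(1)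
        by (simp add: f_def[abs_def] has_vector_derivative_def)
  have diag: "det (mat 1 + mat (u - 1) ** E) = u" for u
  proof -
    have "det (mat 1 + mat (u - 1) ** E) = (\<Prod>i\<in>UNIV. (mat 1 + mat (u - 1) ** E) $ i $ i)"
      by (rule det_diagonal) (auto simp: E_def mat_mult_eq, auto simp: mat_def)
    also have "\<dots> = (\<Prod>i\<in>UNIV. if i = i0 then u else 1)"
      by (intro prod.cong) (auto simp: E_def mat_mult_eq, auto simp: mat_def)
    finally show ?thesis by simp
  qed
  show ?thesis
  proof
    show "c 0 = mat_of p" by (simp add: c_def f0)
    \<comment> \<open>The derivative of \<open>f\<close> at 0 is \<open>trace Z = 0\<close>, so the
      rescaling factor is stationary there and only \<open>mat 1 + t *\<^sub>R Z\<close> contributes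
      to the velocity.\<close>
    have "((\<lambda>t. inverse (f t) - 1) has_derivative (\<lambda>t. 0)) (at 0)"
      by (auto intro!: derivative_eq_intros f' simp: f0)
    from has_derivative_matrix_mult[OF has_derivative_mat[OF this] has_derivative_const[of E]]
    have "((\<lambda>t. mat_of p ** (mat 1 + mat (inverse (f t) - 1) ** E)) has_derivative (\<lambda>t. 0)) (at 0)"
      using has_derivative_matrix_mult[OF has_derivative_const[of "mat_of p"]
          has_derivative_add[OF has_derivative_const[of "mat 1"]]]
      by fastforce
    moreover have "((\<lambda>t. mat 1 + t *\<^sub>R Z) has_derivative (\<lambda>t. t *\<^sub>R Z)) (at 0)"
      by (auto intro!: derivative_eq_intros)
    ultimately have "(c has_derivative (\<lambda>t. t *\<^sub>R y)) (at 0)"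
      unfolding c_def[abs_def] using has_derivative_matrix_mult
          by (fastforce simp: f0 Z(2) matrix_distribs)
    then show "(c has_vector_derivative y) (at 0)" by (simp add: has_vector_derivative_def)
    have "isCont f 0" using f' by (rule has_derivative_continuous)
    then have "(f \<longlongrightarrow> f 0) (nhds 0)" by (simp only: isCont_def tendsto_at_iff_tendsto_nhds)
    then have "eventually (\<lambda>t. f t \<noteq> 0) (nhds 0)" by (rule tendsto_imp_eventually_ne) (simp add: f0)
    then show "eventually (\<lambda>t. det (c t) = 1) (nhds 0)"
      by eventually_elim (simp add: c_def det_mul diag flip: f_def)
  qed
qed

text \<open>The set \<open>{A. det A = 1}\<close> is not open, so a derivative within it need not be
  unique in all directions. For tangent \<open>y\<close>, composing with a curve of velocity
  \<open>y\<close> that stays in the set turns both candidates into the ordinary derivative of one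
  function of a real variable.\<close>

lemma derivative_unique_tangent_space:
  assumes f': "(f has_derivative f') (at (mat_of p) within {A. det A = 1})"
    and f'': "(f has_derivative f'') (at (mat_of p) within {A. det A = 1})"
    and y: "y \<in> tangent_space p"
  shows "f' y = f'' y"
proof -
  obtain c where c: "c 0 = mat_of p" "(c has_vector_derivative y) (at 0)"
    and "eventually (\<lambda>t. det (c t) = 1) (nhds (0::real))"
    using tangent_vector_curve[OF y] by metis
  then obtain T where T: "open T" "(0::real) \<in> T" "\<And>t. t \<in> T \<Longrightarrow> det (c t) = 1"
    by (auto simp: eventually_nhds)
  have "((\<lambda>t. f (c t)) has_vector_derivative g y) (at 0)"
    if "(f has_derivative g) (at (mat_of p) within {A. det A = 1})" for g
  proof -
    have "((\<lambda>t. f (c t)) has_derivative (\<lambda>t. g (t *\<^sub>R y))) (at 0 within T)"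
    proof (rule has_derivative_in_compose[of c "\<lambda>t. t *\<^sub>R y" 0 T f g])
      show "(c has_derivative (\<lambda>t. t *\<^sub>R y)) (at 0 within T)"
        using c(2) by (auto simp: has_vector_derivative_def intro: has_derivative_at_withinI)
      show "(f has_derivative g) (at (c 0) within c ` T)"
        unfolding c(1) by (rule has_derivative_subset[OF that]) (use T in auto)
    qed
    then show ?thesis
      by (simp add: has_vector_derivative_def at_within_open[OF T(2,1)]
        linear_scale[OF bounded_linear.linear[OF has_derivative_bounded_linear[OF that]]])
  qed
  from vector_derivative_unique_at[OF this[OF f'] this[OF f'']] show ?thesis .
qed

text \<open>\<open>frechet_derivative\<close> is an arbitrary choice among derivatives; on tangent
  vectors all choices agree, so any known derivative computes the differential.\<close>

lemma differential_eq:
  assumes "((\<lambda>A. f (Abs_SL A)) has_derivative f') (at (mat_of p) within {A. det A = 1})"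
    "y \<in> tangent_space p"
  shows "differential f p y = f' y"
proof -
  have "((\<lambda>A. f (Abs_SL A)) has_derivative differential f p) (at (mat_of p) within {A. det A = 1})"
    unfolding differential_def[abs_def] frechet_derivative_works[symmetric] differentiable_def
        using assms by blast
  from derivative_unique_tangent_space[OF this assms] show ?thesis .
qed

lemma smooth_has_derivative:
  assumes "smooth f"
  shows "((\<lambda>A. f (Abs_SL A)) has_derivative differential f p) (at (mat_of p) within {A. det A = 1})"
proof -
  obtain U F where U: "open U" "mat_of p \<in> U" "\<And>k. Ck_on k U F"
    "\<And>q. mat_of q \<in> U \<Longrightarrow> F (mat_of q) = f q"
    using assms unfolding smooth_def by metis
  have "F differentiable (at (mat_of p))" using U(3)[of "Suc 0"] U(2) by simp
  then obtain F' where F': "(F has_derivative F') (at (mat_of p))"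
      by (auto simp: differentiable_def)
  obtain e where e: "0 < e" "ball (mat_of p) e \<subseteq> U" using U(1,2) by (meson openE)
  have "((\<lambda>A. f (Abs_SL A)) has_derivative F') (at (mat_of p) within {A. det A = 1})"
  proof (rule has_derivative_transform_within[OF has_derivative_at_withinI[OF F'] e(1)])
    fix A :: "complex^'a^'a" assume A: "A \<in> {A. det A = 1}" "dist A (mat_of p) < e"
    then have "mat_of (Abs_SL A) \<in> U" using e(2) by (auto simp: mat_of_Abs_SL dist_commute)
    from U(4)[OF this] A show "F A = f (Abs_SL A)" by (simp add: mat_of_Abs_SL)
  qed simp
  then show ?thesis
    unfolding differential_def[abs_def] frechet_derivative_works[symmetric] differentiable_def
        by blast
qed

lemma linear_differential: "smooth f \<Longrightarrow> linear (differential f p)"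
  using smooth_has_derivative has_derivative_bounded_linear bounded_linear.linear by blast

section \<open>Smoothness of linear and quadratic maps\<close>

lemma Ck_on_bounded_linear:
  assumes "bounded_linear f"
  shows "Ck_on k UNIV (\<lambda>x. c + f x)"
proof (cases k)
  case (Suc j)
  have const: "Ck_on j UNIV (\<lambda>x::'a. c :: 'b)" for j c
    by (induction j arbitrary: c) (simp_all add: frechet_derivative_const)
  have "((\<lambda>x. c + f x) has_derivative f) (at x)" for x
    using has_derivative_add[OF has_derivative_const bounded_linear_imp_has_derivative[OF assms]]
        by simp
  then have "frechet_derivative (\<lambda>x. c + f x) (at x) = f"
    "(\<lambda>x. c + f x) differentiable at x" for x
    using frechet_derivative_at by (metis, metis differentiable_def)
  then show ?thesis by (simp add: Suc const)
next
  case 0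
  then show ?thesis
    by (simp add: continuous_on_add[OF continuous_on_const linear_continuous_on[OF assms]])
qed

text \<open>The derivative in a fixed direction \<open>w\<close> is linear in \<open>x\<close>, so
  one unfolding of the recursion reduces to \<open>Ck_on_bounded_linear\<close>.\<close>

lemma Ck_on_bounded_bilinear:
  assumes "bounded_bilinear f"
  shows "Ck_on k UNIV (\<lambda>x. f x x)"
proof (cases k)
  case 0
  then show ?thesis using bounded_bilinear.continuous_on[OF assms]
      by (auto intro: continuous_intros)
next
  case (Suc j)
  have "((\<lambda>x. f x x) has_derivative (\<lambda>w. f x w + f w x)) (at x)" for x
    using bounded_bilinear.FDERIV[OF assms has_derivative_ident has_derivative_ident] .
  moreover have "bounded_linear (\<lambda>x. f x w + f w x)" for w
    using assms by (intro bounded_linear_add bounded_bilinear.bounded_linear_left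
        bounded_bilinear.bounded_linear_right)
  then have "Ck_on j UNIV (\<lambda>x. f x w + f w x)" for w
    using Ck_on_bounded_linear[of "\<lambda>x. f x w + f w x" j 0] by simp
  moreover from calculation have "frechet_derivative (\<lambda>x. f x x) (at x)
      = (\<lambda>w. f x w + f w x)" "(\<lambda>x. f x x) differentiable at x" for x
    using frechet_derivative_at by (metis, metis differentiable_def)
  ultimately show ?thesis by (simp add: Suc)
qed

lemma smoothI:
  assumes "\<And>k. Ck_on k UNIV F" "\<And>q. F (mat_of q) = f q"
  shows "smooth f"
  unfolding smooth_def using assms by (intro allI exI[of _ UNIV] exI[of _ F]) auto

lemma smooth_linear:
  assumes "bounded_linear F"
  shows "smooth (\<lambda>q. F (mat_of q))"
  using Ck_on_bounded_linear[OF assms, of _ 0] by (intro smoothI[of F]) simp_all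

lemma smooth_field_left_inv_field:
  assumes "y \<in> tangent_space p" shows "smooth_field (left_inv_field p y)"
  unfolding smooth_field_def vector_field_def
proof
  show "\<forall>q. left_inv_field p y q \<in> tangent_space q"
    using assms by (simp add: tangent_space_iff left_inv_field_def matrix_mul_assoc)
  show "smooth (left_inv_field p y)"
    unfolding left_inv_field_def[abs_def]
    by (rule smooth_linear) (rule bounded_bilinear.bounded_linear_left[OF
        bounded_bilinear_matrix_mult])
qed

lemma left_inv_field_self [simp]: "left_inv_field p y p = y"
  by (simp add: left_inv_field_def matrix_mul_assoc)

section \<open>Nondegeneracy of the metric and uniqueness of the connection\<close>

lemma metric_diff_left: "metric p (x - y) z = metric p x z - metric p y z"
  by (simp add: metric_def matrix_distribs trace_linears)

lemma metric_commute: "metric p x y = metric p y x"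
  unfolding metric_def by (subst trace_mul_sym) (rule refl)

text \<open>The form is indefinite, so \<open>x\<close> is paired not with itself but with the
  tangent vector obtained from the conjugate transpose \<open>V\<close> of \<open>W\<close>, which
  is again trace-free. The pairing is then minus the sum of the squared moduli of the entries of
  \<open>W\<close>.\<close>

lemma metric_nondegenerate:
  assumes x: "x \<in> tangent_space p" and 0: "\<And>y. y \<in> tangent_space p \<Longrightarrow> metric p x y = 0"
  shows "x = 0"
proof -
  define W where "W = matrix_inv (mat_of p) ** x"
  define V where "V = (\<chi> i j. cnj (W $ j $ i))"
  have "trace V = cnj (trace W)" by (simp add: trace_def V_def)
  then have "mat_of p ** V \<in> tangent_space p"
    using x by (simp add: tangent_space_iff W_def matrix_mul_assoc)
  from 0[OF this] have "Re (trace (W ** V)) = 0"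
    by (simp add: metric_def W_def matrix_mul_assoc)
  moreover have "Re (trace (W ** V)) = (\<Sum>i\<in>UNIV. \<Sum>j\<in>UNIV. (cmod (W $ i $ j))\<^sup>2)"
    by (simp add: trace_def matrix_matrix_mult_def V_def cmod_power2) (simp add: power2_eq_square)
  ultimately have "W = 0"
    by (simp add: sum_nonneg_eq_0_iff sum_nonneg vec_eq_iff)
  then have "mat_of p ** W = 0" by (simp add: matrix_matrix_mult_def vec_eq_iff)
  then show ?thesis by (simp add: W_def matrix_mul_assoc)
qed

lemma is_levi_civitaD:
  assumes "is_levi_civita D" "smooth_field X" "smooth_field Y"
  shows "vector_field (D X Y)" "D X Y p - D Y X p = bracket X Y p"
    "smooth_field Z \<Longrightarrow> differential (\<lambda>q. metric q (Y q) (Z q)) p (X p) =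
       metric p (D X Y p) (Z p) + metric p (Y p) (D X Z p)"
  using assms(2,3) assms(1)[unfolded is_levi_civita_def] by simp_all

text \<open>The difference of two Levi-Civita connections gives a trilinear form \<open>g(D X Y - D' X Y, Z)\<close>
  that is symmetric in \<open>X, Y\<close> and skew in \<open>Y, Z\<close>, hence zero.\<close>

lemma levi_civita_unique:
  assumes D: "is_levi_civita D" and D': "is_levi_civita D'"
    and X: "smooth_field X" and Y: "smooth_field Y"
  shows "D X Y p = D' X Y p"
proof -
  define T where "T X Y Z = metric p (D X Y p - D' X Y p) (Z p)" for X Y Z
  have sym: "T X Y Z = T Y X Z" if "smooth_field X" "smooth_field Y" for X Y Z
  proof -
    have "D X Y p - D Y X p = bracket X Y p" "D' X Y p - D' Y X p = bracket X Y p"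
      using is_levi_civitaD(2)[OF D that] is_levi_civitaD(2)[OF D' that] .
    then have "D X Y p - D' X Y p = D Y X p - D' Y X p" by (simp add: algebra_simps)
    then show ?thesis by (simp add: T_def)
  qed
  have skew: "T X Y Z = - T X Z Y" if "smooth_field X" "smooth_field Y" "smooth_field Z" for X Y Z
  proof -
    have "differential (\<lambda>q. metric q (Y q) (Z q)) p (X p)
        = metric p (D X Y p) (Z p) + metric p (Y p) (D X Z p)"
         "differential (\<lambda>q. metric q (Y q) (Z q)) p (X p)
             = metric p (D' X Y p) (Z p) + metric p (Y p) (D' X Z p)"
      using is_levi_civitaD(3)[OF D that] is_levi_civitaD(3)[OF D' that] .
    then show ?thesis by (simp add: T_def metric_diff_left metric_commute[of p "Y p"])
  qed
  \<comment> \<open>Alternating the two symmetries gives \<open>T X Y Z = T Y X Z = - T Y Z X = - T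
    Z Y X = T Z X Y = T X Z Y = - T X Y Z\<close>.\<close>
  have zero: "T X Y Z = 0" if "smooth_field Z" for Z
    using sym[OF X Y] sym[OF Y that] sym[OF X that] skew[OF X Y that] skew[OF Y X that] skew[OF
        that X Y]
    by (smt (verit) X Y sym that)
  have "D X Y p - D' X Y p = 0"
  proof (rule metric_nondegenerate)
    have "vector_field (D X Y)" "vector_field (D' X Y)"
      using is_levi_civitaD(1)[OF D X Y] is_levi_civitaD(1)[OF D' X Y] .
    then show "D X Y p - D' X Y p \<in> tangent_space p"
      by (auto simp: vector_field_def intro: subspace_diff[OF subspace_tangent_space])
    \<comment> \<open>Every tangent vector at \<open>p\<close> is the value of a left-invariant
      field, so vanishing against fields suffices.\<close>
    show "metric p (D X Y p - D' X Y p) y = 0" if "y \<in> tangent_space p" for y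
      using zero[OF smooth_field_left_inv_field[OF that]] by (simp add: T_def)
  qed
  then show ?thesis by simp
qed

text \<open>Left-invariant fields satisfy \<open>D X Y = [X, Y]/2\<close> because the metric is
  bi-invariant; the Leibniz rule extends this to the following formula.\<close>

definition sl_connection ::
  "('n::finite SL \<Rightarrow> complex^'n^'n) \<Rightarrow> ('n SL \<Rightarrow> complex^'n^'n) \<Rightarrow> 'n SL \<Rightarrow> complex^'n^'n" where
  "sl_connection X Y p = differential Y p (X p) -
     (1/2) *\<^sub>R (X p ** matrix_inv (mat_of p) ** Y p + Y p ** matrix_inv (mat_of p) ** X p)"

text \<open>Tangency of \<open>Y\<close> says that
  \<open>trace (matrix_inv A ** Y (Abs_SL A))\<close> vanishes on the group. Differentiating this
  along \<open>X p\<close> gives the trace of the derivative term; by cyclicity the symmetrised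
  correction has the same trace, and the two cancel.\<close>

lemma vector_field_sl_connection:
  assumes X: "smooth_field X" and Y: "smooth_field Y"
  shows "vector_field (sl_connection X Y)"
  unfolding vector_field_def
proof
  fix p :: "'a SL"
  let ?m = "matrix_inv (mat_of p)" and ?S = "{A :: complex^'a^'a. det A = 1}"
  have Xp: "X p \<in> tangent_space p" using X by (simp add: smooth_field_def vector_field_def)
  have Ysm: "smooth Y" using Y by (simp add: smooth_field_def)
  have "((\<lambda>A. trace (matrix_inv A ** Y (Abs_SL A))) has_derivative
      (\<lambda>w. trace (?m ** differential Y p w + - (?m ** w ** ?m) ** Y p))) (at (mat_of p) within ?S)"
    using has_derivative_trace[OF has_derivative_matrix_mult[OF has_derivative_matrix_inv[OF
        det_mat_of] smooth_has_derivative[OF Ysm]]]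
    by (simp add: mat_of_inverse)
  moreover have "((\<lambda>A. trace (matrix_inv A ** Y (Abs_SL A)))
      has_derivative (\<lambda>w. 0)) (at (mat_of p) within ?S)"
  proof (rule has_derivative_transform[where f="\<lambda>A. 0"])
    fix A assume "A \<in> ?S"
    moreover have "Y (Abs_SL A) \<in> tangent_space (Abs_SL A)" using Y
        by (simp add: smooth_field_def vector_field_def)
    ultimately show "trace (matrix_inv A ** Y (Abs_SL A)) = 0"
        by (simp add: tangent_space_iff mat_of_Abs_SL)
  qed auto
  ultimately have "trace (?m ** differential Y p (X p) + - (?m ** X p ** ?m) ** Y p) = 0"
    by (rule derivative_unique_tangent_space[OF _ _ Xp])
  then have "trace (?m ** differential Y p (X p)) = trace (?m ** X p ** ?m ** Y p)"
    by (simp add: matrix_distribs trace_linears)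
  moreover have "trace (?m ** Y p ** ?m ** X p) = trace (?m ** X p ** ?m ** Y p)"
    using trace_mul_sym[of "?m ** Y p" "?m ** X p"] by (simp add: matrix_mul_assoc)
  ultimately show "sl_connection X Y p \<in> tangent_space p"
    by (simp add: tangent_space_iff sl_connection_def matrix_distribs trace_linears
        matrix_mul_assoc)
qed

text \<open>The metric pairs the left translates \<open>matrix_inv A ** Y\<close> and
  \<open>matrix_inv A ** Z\<close>, and differentiating the inverse produces the cubic terms
  \<open>- m X m Y m Z\<close> and \<open>- m Y m X m Z\<close> under the trace, where
  \<open>m\<close> is the inverse at \<open>p\<close>. The two corrections on the right produce the
  same terms once \<open>m Y m Z m X\<close> is rotated cyclically.\<close>

lemma metric_compatible_sl_connection:
  assumes X: "smooth_field X" and Y: "smooth_field Y" and Z: "smooth_field Z"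
  shows "differential (\<lambda>q. metric q (Y q) (Z q)) p (X p) =
      metric p (sl_connection X Y p) (Z p) + metric p (Y p) (sl_connection X Z p)"
proof -
  let ?m = "matrix_inv (mat_of p)" and ?S = "{A :: complex^'a^'a. det A = 1}"
  have Xp: "X p \<in> tangent_space p" using X by (simp add: smooth_field_def vector_field_def)
  define dY dZ where "dY = differential Y p" and "dZ = differential Z p"
  have der: "((\<lambda>A. matrix_inv A ** V (Abs_SL A)) has_derivative
      (\<lambda>w. ?m ** differential V p w - ?m ** w ** ?m ** V p)) (at (mat_of p) within ?S)"
          if "smooth_field V" for V
    using has_derivative_matrix_mult[OF has_derivative_matrix_inv[OF det_mat_of]
        smooth_has_derivative, of V] that
    by (simp add: mat_of_inverse matrix_distribs smooth_field_def)
  have "((\<lambda>A. - Re (trace ((matrix_inv A ** Y (Abs_SL A)) ** (matrix_inv A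
      ** Z (Abs_SL A))))) has_derivative
      (\<lambda>w. - Re (trace ((?m ** Y p) ** (?m ** dZ w - ?m ** w ** ?m ** Z p) +
         (?m ** dY w - ?m ** w ** ?m ** Y p) ** (?m ** Z p))))) (at (mat_of p) within ?S)"
    using has_derivative_minus[OF has_derivative_Re[OF has_derivative_trace[OF
        has_derivative_matrix_mult[OF der[OF Y] der[OF Z]]]]]
    by (simp add: mat_of_inverse dY_def dZ_def)
  then have "((\<lambda>A. metric (Abs_SL A) (Y (Abs_SL A)) (Z (Abs_SL A))) has_derivative
      (\<lambda>w. - Re (trace ((?m ** Y p) ** (?m ** dZ w - ?m ** w ** ?m ** Z p) +
         (?m ** dY w - ?m ** w ** ?m ** Y p) ** (?m ** Z p))))) (at (mat_of p) within ?S)"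
    by (rule has_derivative_transform[rotated 2]) (simp_all add: metric_def mat_of_Abs_SL)
  from differential_eq[OF this Xp]
  have "differential (\<lambda>q. metric q (Y q) (Z q)) p (X p)
      = - Re (trace ((?m ** Y p) ** (?m ** dZ (X p) - ?m ** X p ** ?m ** Z p) +
         (?m ** dY (X p) - ?m ** X p ** ?m ** Y p) ** (?m ** Z p)))" .
  moreover have "trace (?m ** Y p ** ?m ** Z p ** ?m ** X p)
      = trace (?m ** X p ** ?m ** Y p ** ?m ** Z p)"
    using trace_mul_sym[of "?m ** Y p ** ?m ** Z p" "?m ** X p"] by (simp add: matrix_mul_assoc)
  ultimately show ?thesis
    by (simp add: metric_def sl_connection_def matrix_distribs trace_linears matrix_mul_assoc
        flip: dY_def dZ_def)
      (simp add: field_simps)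
qed

text \<open>The correction term is symmetric in both fields, so it drops out of the torsion, and it
  is linear over functions, so the Leibniz rule comes from the derivative term alone.\<close>

lemma is_levi_civita_sl_connection: "is_levi_civita sl_connection"
  unfolding is_levi_civita_def
proof (intro conjI allI impI)
  fix X Y Z X' Y' :: "'a SL \<Rightarrow> complex^'a^'a" and f :: "'a SL \<Rightarrow> real" and p
  assume X: "smooth_field X" and Y: "smooth_field Y"
  have Xp: "X p \<in> tangent_space p" using X by (simp add: smooth_field_def vector_field_def)
  have lin: "linear (differential Y p)" using Y by (simp add: smooth_field_def linear_differential)
  have dY: "((\<lambda>A. Y (Abs_SL A)) has_derivative differential Y p) (at (mat_of p) within {A. det A
      = 1})"
    using Y by (simp add: smooth_field_def smooth_has_derivative)
  show "vector_field (sl_connection X Y)" using X Y by (rule vector_field_sl_connection)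
  show "sl_connection X Y p - sl_connection Y X p = bracket X Y p"
    by (simp add: sl_connection_def bracket_def algebra_simps)
  show "sl_connection (\<lambda>q. X q + X' q) Y p = sl_connection X Y p + sl_connection X' Y p"
    by (simp add: sl_connection_def linear_add[OF lin] matrix_distribs algebra_simps)
  show "differential (\<lambda>q. metric q (Y q) (Z q)) p (X p) =
      metric p (sl_connection X Y p) (Z p) + metric p (Y p) (sl_connection X Z p)"
          if "smooth_field Z"
    using X Y that by (rule metric_compatible_sl_connection)
  show "sl_connection X (\<lambda>q. Y q + Y' q) p = sl_connection X Y p + sl_connection X Y' p"
      if Y': "smooth_field Y'"
  proof -
    have "((\<lambda>A. Y' (Abs_SL A)) has_derivative differential Y' p) (at (mat_of p) within {A. det A
        = 1})"
      using Y' by (simp add: smooth_field_def smooth_has_derivative)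
    from differential_eq[OF has_derivative_add[OF dY this] Xp] show ?thesis
      by (simp add: sl_connection_def matrix_distribs algebra_simps)
  qed
  assume f: "smooth f"
  show "sl_connection (\<lambda>q. f q *\<^sub>R X q) Y p = f p *\<^sub>R sl_connection X Y p"
    by (simp add: sl_connection_def linear_scale[OF lin] matrix_distribs algebra_simps)
  from differential_eq[OF has_derivative_scaleR[OF smooth_has_derivative[OF f] dY] Xp]
  show "sl_connection X (\<lambda>q. f q *\<^sub>R Y q) p
      = differential f p (X p) *\<^sub>R Y p + f p *\<^sub>R sl_connection X Y p"
    by (simp add: sl_connection_def matrix_distribs mat_of_inverse algebra_simps)
qed

lemma levi_civita_eq:
  assumes "smooth_field X" "smooth_field Y"
  shows "levi_civita X Y p = sl_connection X Y p"
proof -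
  have "is_levi_civita levi_civita"
    unfolding levi_civita_def by (rule someI[of is_levi_civita, OF is_levi_civita_sl_connection])
  from levi_civita_unique[OF this is_levi_civita_sl_connection assms] show ?thesis .
qed

subsection \<open>Gradients and divergences\<close>

lemma mat_diff: "mat (a - b) = mat a - (mat b :: 'a::ring_1^'n^'n)"
  by (simp add: mat_def vec_eq_iff)

lemma bounded_linear_mat_trace: "bounded_linear (\<lambda>A. mat (trace (N ** A) / c) :: complex^'n^'n)"
  for N :: "complex^'n^'n"
  by (intro bounded_linear_compose[OF bounded_linear_mat] bounded_linear_compose[OF
      bounded_linear_divide]
      bounded_linear_compose[OF bounded_linear_trace] bounded_bilinear.bounded_linear_right[OF
          bounded_bilinear_matrix_mult])

lemma mat_mult_mat: "mat a ** (mat b ** A) = mat (a * b) ** A" for A :: "'a::semiring_1^'n^'n"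
  by (simp add: mat_mult_eq mult.assoc)

lemma trace_mat_mult_mult: "trace (mat c ** A ** B) = c * trace (A ** B)"
    for A B :: "'a::comm_semiring_1^'n^'n"
  by (simp add: trace_mat_mult flip: matrix_mul_assoc)

text \<open>At \<open>q\<close> this is \<open>q\<close> times the trace-free part of
  \<open>- N q\<close>. Factoring out \<open>mat_of q\<close> on the right displays it as the
  restriction of a quadratic map, to which \<open>Ck_on_bounded_bilinear\<close> applies.\<close>

definition grad_field :: "complex^'n^'n \<Rightarrow> 'n::finite SL \<Rightarrow> complex^'n^'n" where
  "grad_field N q = (mat (trace (N ** mat_of q) / of_nat CARD('n)) - mat_of q ** N) ** mat_of q"

lemma matrix_inv_grad_field:
  fixes N :: "complex^'n^'n"
  shows "matrix_inv (mat_of p) ** grad_field N p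
      = mat (trace (N ** mat_of p) / of_nat CARD('n)) - N ** mat_of p"
  by (simp add: grad_field_def matrix_distribs mult_mat_left_commute matrix_mul_assoc)
     (simp add: matrix_mul_assoc[symmetric] mult_mat_left_commute)

lemma grad_field_tangent: "grad_field N p \<in> tangent_space p"
  by (simp add: tangent_space_iff matrix_inv_grad_field trace_linears)

lemma smooth_field_grad_field: "smooth_field (grad_field N)"
  for N :: "complex^'n^'n"
  unfolding smooth_field_def vector_field_def
proof
  have "bounded_linear (\<lambda>A. mat (trace (N ** A) / of_nat CARD('n)) - A ** N)"
    by (intro bounded_linear_sub bounded_linear_mat_trace bounded_bilinear.bounded_linear_left[OF
        bounded_bilinear_matrix_mult])
  from bounded_bilinear.comp1[OF bounded_bilinear_matrix_mult this]
  show "smooth (grad_field N)"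
    by (rule smoothI[OF Ck_on_bounded_bilinear]) (simp add: grad_field_def)
qed (simp add: grad_field_tangent)

lemma grad_Re_trace:
  fixes N :: "complex^'n^'n"
  shows "grad (\<lambda>q. Re (trace (N ** mat_of q))) p = grad_field N p"
proof -
  have diff: "differential (\<lambda>q. Re (trace (N ** mat_of q))) p y = Re (trace (N ** y))"
      if "y \<in> tangent_space p" for y
  proof (rule differential_eq[OF _ that])
    have "((\<lambda>A. Re (trace (N ** A))) has_derivative (\<lambda>w. Re (trace (N ** w))))
        (at (mat_of p) within {A. det A = 1})"
      by (intro has_derivative_Re has_derivative_trace bounded_linear.has_derivative[OF
            bounded_bilinear.bounded_linear_right[OF bounded_bilinear_matrix_mult]]
                has_derivative_ident)
    then show "((\<lambda>A. Re (trace (N ** mat_of (Abs_SL A))))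
        has_derivative (\<lambda>w. Re (trace (N ** w)))) (at (mat_of p) within {A. det A = 1})"
      by (rule has_derivative_transform[rotated 2]) (simp_all add: mat_of_Abs_SL)
  qed
  \<comment> \<open>Since \<open>matrix_inv (mat_of p) ** y\<close> is trace-free, the scalar part
    of the gradient contributes nothing to the pairing.\<close>
  have met: "metric p (grad_field N p) y = Re (trace (N ** y))" if "y \<in> tangent_space p" for y
    using that by (simp add: metric_def matrix_inv_grad_field tangent_space_iff matrix_distribs
        trace_linears matrix_mul_assoc trace_mat_mult_mult)
  show ?thesis
    unfolding grad_def
  proof (rule the_equality)
    show "grad_field N p \<in> tangent_space p \<and>
      (\<forall>y\<in>tangent_space p. metric p (grad_field N p) y
          = differential (\<lambda>q. Re (trace (N ** mat_of q))) p y)"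
      using grad_field_tangent met diff by simp
    fix w assume w: "w \<in> tangent_space p \<and> (\<forall>y\<in>tangent_space p. metric p w y
        = differential (\<lambda>q. Re (trace (N ** mat_of q))) p y)"
    have "w - grad_field N p = 0"
      by (rule metric_nondegenerate)
         (use w met diff in \<open>auto simp: metric_diff_left subspace_diff[OF subspace_tangent_space]
             grad_field_tangent\<close>)
    then show "w = grad_field N p" by simp
  qed
qed

lemma differential_grad_field:
  fixes N :: "complex^'n^'n"
  assumes "y \<in> tangent_space p"
  shows "differential (grad_field N) p y = mat (trace (N ** mat_of p) / of_nat CARD('n)) ** y
     + mat (trace (N ** y) / of_nat CARD('n)) ** mat_of p - (mat_of p ** N ** y + y ** N
         ** mat_of p)"
proof (rule differential_eq[OF _ assms])
  let ?n = "of_nat CARD('n) :: complex"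
  have "((\<lambda>A. (mat (trace (N ** A) / ?n) - A ** N) ** A) has_derivative
     (\<lambda>y. (mat (trace (N ** mat_of p) / ?n) - mat_of p ** N) ** y
        + (mat (trace (N ** y) / ?n) - (mat_of p ** 0 + y ** N)) ** mat_of p))
            (at (mat_of p) within {A. det A = 1})"
    by (intro has_derivative_matrix_mult has_derivative_diff bounded_linear.has_derivative[OF
        bounded_linear_mat_trace]
        has_derivative_ident has_derivative_const)
  then have "((\<lambda>A. (mat (trace (N ** A) / ?n) - A ** N) ** A) has_derivative
     (\<lambda>y. mat (trace (N ** mat_of p) / ?n) ** y + mat (trace (N ** y) / ?n) ** mat_of p
        - (mat_of p ** N ** y + y ** N ** mat_of p))) (at (mat_of p) within {A. det A = 1})"
    by (rule has_derivative_eq_rhs) (simp add: fun_eq_iff matrix_distribs algebra_simps)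
  then show "((\<lambda>A. grad_field N (Abs_SL A)) has_derivative
     (\<lambda>y. mat (trace (N ** mat_of p) / ?n) ** y + mat (trace (N ** y) / ?n) ** mat_of p
        - (mat_of p ** N ** y + y ** N ** mat_of p))) (at (mat_of p) within {A. det A = 1})"
    by (rule has_derivative_transform[rotated 2]) (simp_all add: mat_of_Abs_SL grad_field_def)
qed

text \<open>The multiple \<open>mat c ** y\<close> in the differential is cancelled by the
  correction term, which also halves the remaining products with \<open>N\<close>.\<close>

lemma sl_connection_grad_field:
  fixes N :: "complex^'n^'n"
  assumes "y \<in> tangent_space p"
  shows "sl_connection (left_inv_field p y) (grad_field N) p =
    mat (trace (N ** y) / of_nat CARD('n)) ** mat_of p - (1/2) *\<^sub>R (y ** N ** mat_of p + mat_of p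
        ** N ** y)"
proof -
  define c where "c = trace (N ** mat_of p) / of_nat CARD('n)"
  define k where "k = mat (trace (N ** y) / of_nat CARD('n)) ** mat_of p"
  have "y ** matrix_inv (mat_of p) ** grad_field N p = mat c ** y - y ** N ** mat_of p"
    unfolding matrix_mul_assoc[symmetric] matrix_inv_grad_field matrix_distribs mult_mat_commute
        c_def ..
  moreover have "grad_field N p ** matrix_inv (mat_of p) ** y = mat c ** y - mat_of p ** N ** y"
    by (simp add: grad_field_def matrix_distribs c_def)
  ultimately show ?thesis
    by (simp add: sl_connection_def differential_grad_field[OF assms] flip: c_def k_def)
       (simp add: algebra_simps flip: scaleR_add_left)
qed

lemma divergence_grad_field:
  fixes N :: "complex^'n^'n"
  shows "divergence (grad_field N) p =
    - (2 * (real CARD('n) ^ 2 - 1) / real CARD('n)) * Re (trace (N ** mat_of p))"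
proof -
  let ?n = "of_nat CARD('n) :: complex" and ?P = "mat_of p" and ?m = "matrix_inv (mat_of p)"
  define proj where "proj y = y - mat (trace (?m ** y) / ?n) ** ?P" for y
  \<comment> \<open>\<open>T\<close> extends the covariant derivative of the gradient from tangent
    vectors to all matrices, as \<open>trace_on_eq_sum_Basis\<close> requires.\<close>
  define T where "T y = mat (trace (N ** proj y) / ?n) ** ?P - (1/2) *\<^sub>R (proj y ** N ** ?P + ?P
      ** N ** proj y)" for y
  have proj: "proj y \<in> tangent_space p" for y
    by (simp add: tangent_space_iff proj_def matrix_distribs mult_mat_left_commute trace_linears)
  have proj_eq: "proj y = y" if "y \<in> tangent_space p" for y
    using that by (simp add: proj_def tangent_space_iff)
  have "linear proj"
  proof -
    define f :: "complex^'n^'n \<Rightarrow> complex^'n^'n" where "f y = mat (trace (?m ** y) / ?n)" for y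
    have "linear f" unfolding f_def[abs_def]
        by (rule bounded_linear.linear[OF bounded_linear_mat_trace])
    have eq: "proj y = y - f y ** ?P" for y by (simp only: proj_def f_def)
    show ?thesis
      using \<open>linear f\<close> by (simp add: linear_iff eq matrix_distribs algebra_simps)
  qed
  then have linT: "linear T"
  proof -
    assume proj: "linear proj"
    define f :: "complex^'n^'n \<Rightarrow> complex^'n^'n" where "f y = mat (trace (N ** y) / ?n)" for y
    have "linear f" unfolding f_def[abs_def]
        by (rule bounded_linear.linear[OF bounded_linear_mat_trace])
    have eq: "T y = f (proj y) ** ?P - (1/2) *\<^sub>R (proj y ** N ** ?P + ?P ** N ** proj y)" for y
      by (simp only: T_def f_def)
    show ?thesis
      using proj \<open>linear f\<close> by (simp add: linear_iff eq matrix_distribs algebra_simps)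
  qed
  have T: "T y = sl_connection (left_inv_field p (proj y)) (grad_field N) p" for y
    unfolding T_def sl_connection_grad_field[OF proj] ..
  have "divergence (grad_field N) p = (\<Sum>e\<in>Basis. T e \<bullet> e)"
    unfolding divergence_def
  proof (rule trace_on_eq_sum_Basis[OF subspace_tangent_space linT])
    show "range T \<subseteq> tangent_space p"
      using vector_field_sl_connection[OF smooth_field_left_inv_field[OF proj]
          smooth_field_grad_field]
      by (auto simp: T vector_field_def)
    show "levi_civita (left_inv_field p y) (grad_field N) p = T y" if "y \<in> tangent_space p" for y
      using levi_civita_eq[OF smooth_field_left_inv_field[OF that] smooth_field_grad_field]
          by (simp add: T proj_eq that)
  qed
  \<comment> \<open>Substituting \<open>proj e\<close> splits the map into rank-one and sandwich
    terms; the factors \<open>mat 1\<close> bring the latter into the shape of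
    \<open>sum_Basis_sandwich\<close>.\<close>
  also have "\<dots> = (\<Sum>e\<in>Basis.
      (mat (trace (N ** e)) ** (mat (1 / ?n) ** ?P)) \<bullet> e
      - (mat (trace (?m ** e)) ** (mat (trace (N ** ?P) / ?n\<^sup>2) ** ?P)) \<bullet> e
      + (mat (trace (?m ** e)) ** (mat (1 / ?n) ** (?P ** N ** ?P))) \<bullet> e
      - (1/2) * ((mat 1 ** e ** (N ** ?P)) \<bullet> e + ((?P ** N) ** e ** mat 1) \<bullet> e))"
  proof (rule sum.cong[OF refl])
    fix e
    define u where "u = trace (?m ** e)"
    have pn: "trace (N ** proj e) / ?n = trace (N ** e) * (1 / ?n) - u * (trace (N ** ?P) / ?n\<^sup>2)"
      by (simp add: proj_def u_def matrix_distribs mult_mat_left_commute trace_linears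
          diff_divide_distrib power2_eq_square)
    have "T e = mat (trace (N ** e)) ** (mat (1 / ?n) ** ?P)
      - mat u ** (mat (trace (N ** ?P) / ?n\<^sup>2) ** ?P)
      - (1/2) *\<^sub>R (e ** N ** ?P + ?P ** N ** e) + mat u ** (mat (1 / ?n) ** (?P ** N ** ?P))"
    proof -
      define X where "X = mat (u * (1 / ?n)) ** (?P ** N ** ?P)"
      have "proj e ** N ** ?P = e ** N ** ?P - X"
        by (simp add: proj_def u_def[symmetric] X_def matrix_distribs matrix_mul_assoc)
      moreover have "?P ** N ** proj e = ?P ** N ** e - X"
        by (simp add: proj_def u_def[symmetric] X_def matrix_distribs mult_mat_left_commute)
      moreover have "e ** N ** ?P - X + (?P ** N ** e - X)
          = (e ** N ** ?P + ?P ** N ** e) - 2 *\<^sub>R X"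
        by (simp add: scaleR_2)
      ultimately have "T e = (mat (trace (N ** e) * (1 / ?n)) - mat (u * (trace (N
          ** ?P) / ?n\<^sup>2))) ** ?P
          - ((1/2) *\<^sub>R (e ** N ** ?P + ?P ** N ** e) - X)"
        by (simp only: T_def pn mat_diff) (simp add: scaleR_diff_right)
      then show ?thesis
        by (simp add: X_def mat_mult_mat matrix_diff_rdistrib)
    qed
    then show "T e \<bullet> e = (mat (trace (N ** e)) ** (mat (1 / ?n) ** ?P)) \<bullet> e
      - (mat (trace (?m ** e)) ** (mat (trace (N ** ?P) / ?n\<^sup>2) ** ?P)) \<bullet> e
      + (mat (trace (?m ** e)) ** (mat (1 / ?n) ** (?P ** N ** ?P))) \<bullet> e
      - (1/2) * ((mat 1 ** e ** (N ** ?P)) \<bullet> e + ((?P ** N) ** e ** mat 1) \<bullet> e)"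
      by (simp add: u_def inner_diff_left inner_add_left matrix_mul_assoc)
  qed
  \<comment> \<open>The second term uses that \<open>?m ** ?P\<close> has trace \<open>?n\<close>,
    and the two sandwich terms each give \<open>?n * trace (N ** ?P)\<close>, with weight one
    half.\<close>
  also have "\<dots> = 2 * Re (trace (N ** ?P) / ?n) - 2 * Re (trace (N ** ?P) / ?n) + 2 * Re (trace (N
      ** ?P) / ?n)
     - 2 * Re (?n * trace (N ** ?P))"
  proof -
    have "trace (?P ** N) = trace (N ** ?P)" by (rule trace_mul_sym)
    moreover have "trace (?m ** (?P ** N ** ?P)) = trace (N ** ?P)" by (simp add: matrix_mul_assoc)
    ultimately show ?thesis
      unfolding sum_subtractf sum.distrib sum_distrib_left[symmetric] sum_Basis_rank_one
          sum_Basis_sandwich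
      unfolding mult_mat_left_commute trace_mat_mult
      by (simp add: trace_I power2_eq_square)
  qed
  also have "\<dots> = - (2 * (real CARD('n) ^ 2 - 1) / real CARD('n)) * Re (trace (N ** mat_of p))"
    by (simp add: field_simps power2_eq_square)
  finally show ?thesis .
qed

section \<open>The operators \<open>tau\<close> and \<open>kappa\<close> on trace functions\<close>

lemma Im_trace_eq: "Im (trace (N ** A)) = Re (trace ((mat (-\<i>) ** N) ** A))"
    for N A :: "complex^'n^'n"
  unfolding matrix_mul_assoc[symmetric] trace_mat_mult by simp

lemma cgrad_trace: "cgrad (\<lambda>q. trace (N ** mat_of q)) p
    = (grad_field N p, grad_field (mat (-\<i>) ** N) p)"
  by (simp add: cgrad_def Im_trace_eq grad_Re_trace)

lemma tau_trace:
  fixes N :: "complex^'n^'n"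
  shows "tau (\<lambda>q. trace (N ** mat_of q)) p =
    - (2 * (of_nat CARD('n) ^ 2 - 1) / of_nat CARD('n)) * trace (N ** mat_of p)"
proof -
  have "(of_nat CARD('n) :: complex) = of_real (real CARD('n))" by simp
  then have "- (2 * (of_nat CARD('n) ^ 2 - 1) / of_nat CARD('n)) =
      complex_of_real (- (2 * (real CARD('n) ^ 2 - 1) / real CARD('n)))" by simp
  then show ?thesis
    by (simp only: tau_def cdivergence_def cgrad_trace fst_conv snd_conv divergence_grad_field
        Im_trace_eq[symmetric])
       (simp add: complex_eq_iff)
qed

text \<open>The metric of two gradients is \<open>- Re (k N N')\<close> with \<open>k\<close>
  complex-bilinear. Replacing \<open>N\<close> by \<open>-i N\<close> for imaginary parts, the four
  pairings in \<open>cmetric\<close> combine to \<open>-2 * k N N'\<close>: real and imaginary parts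
  each arise twice.\<close>

lemma kappa_trace:
  fixes N N' :: "complex^'n^'n"
  shows "kappa (\<lambda>q. trace (N ** mat_of q)) (\<lambda>q. trace (N' ** mat_of q)) p =
    - 2 * (trace (N ** mat_of p ** N' ** mat_of p) - trace (N ** mat_of p) * trace (N'
        ** mat_of p) / of_nat CARD('n))"
proof -
  define k where "k N N' = trace (N ** mat_of p ** N' ** mat_of p) - trace (N ** mat_of p)
      * trace (N' ** mat_of p) / of_nat CARD('n)"
    for N N' :: "complex^'n^'n"
  have tr: "trace ((mat c - X) ** (mat d - Y))
      = of_nat CARD('n) * c * d - c * trace Y - d * trace X + trace (X ** Y)"
    for c d and X Y :: "complex^'n^'n"
    by (simp add: matrix_distribs trace_linears mult_mat_commute[of X])
  have met: "metric p (grad_field N p) (grad_field N' p) = - Re (k N N')"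
      for N N' :: "complex^'n^'n"
    by (simp add: metric_def matrix_inv_grad_field tr k_def matrix_mul_assoc)
  have k: "k (mat c ** N) N' = c * k N N'" "k N (mat c ** N') = c * k N N'"
      for c and N N' :: "complex^'n^'n"
    by (simp_all add: k_def mult_mat_left_commute trace_mat_mult algebra_simps
        flip: matrix_mul_assoc)
  show ?thesis
    by (simp only: kappa_def cmetric_def cgrad_trace fst_conv snd_conv met k)
       (simp add: k_def[symmetric] complex_eq_iff)
qed

section \<open>The family of functions \<open>phi v a\<close>\<close>

lemma phi_eq_trace: "phi v a z = trace (row_outer a v ** mat_of z)"
  by (simp add: phi_def row_outer_def trace_def matrix_matrix_mult_def transpose_def, subst sum.swap)
     (simp add: mult_ac)

lemma trace_row_outer: "trace (row_outer a v ** A) = (\<Sum>j\<in>UNIV. \<Sum>i\<in>UNIV. v $ j * A $ j $ i * a $ i)"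
  by (simp add: row_outer_def trace_def matrix_matrix_mult_def, subst sum.swap) (simp add: mult_ac)

text \<open>In the product of \<open>row_outer a v\<close>, \<open>A\<close> and
  \<open>row_outer b v\<close>, the middle factor \<open>v A b^t\<close> is a scalar, namely
  \<open>trace (row_outer b v ** A)\<close>, and can be pulled out.\<close>

lemma trace_row_outer_mult:
  "trace (row_outer a v ** A ** row_outer b v ** B)
      = trace (row_outer a v ** B) * trace (row_outer b v ** A)"
proof -
  have "row_outer a v ** A ** row_outer b v = mat (trace (row_outer b v ** A)) ** row_outer a v"
    by (simp add: mat_mult_eq trace_row_outer)
       (simp add: row_outer_def matrix_matrix_mult_def vec_eq_iff sum_distrib_left sum_distrib_right,
        subst sum.swap, simp add: mult_ac)
  then show ?thesis by (simp add: trace_mat_mult flip: matrix_mul_assoc)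
qed

lemma kappa_phi:
  fixes v :: "complex^'n"
  shows "kappa (phi v a) (phi v b) p = - (2 * (of_nat CARD('n) - 1) / of_nat CARD('n)) * phi v a p
      * phi v b p"
proof -
  have "phi v a = (\<lambda>q. trace (row_outer a v ** mat_of q))" for a
      by (simp add: fun_eq_iff phi_eq_trace)
  then show ?thesis by (simp add: kappa_trace trace_row_outer_mult field_simps)
qed

lemma tau_phi:
  fixes v :: "complex^'n"
  shows "tau (phi v a) p = - (2 * (of_nat CARD('n) ^ 2 - 1) / of_nat CARD('n)) * phi v a p"
proof -
  have "phi v a = (\<lambda>q. trace (row_outer a v ** mat_of q))" by (simp add: fun_eq_iff phi_eq_trace)
  then show ?thesis by (simp only: tau_trace)
qed

lemma smooth_phi: "smooth (phi v a)"
  unfolding phi_eq_trace[abs_def]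
  by (rule smooth_linear) (rule bounded_linear_compose[OF bounded_linear_trace
    bounded_bilinear.bounded_linear_right[OF bounded_bilinear_matrix_mult]])

lemma linear_phi: "Vector_Spaces.linear (*s) fun_scale (phi v)"
proof -
  interpret F: vector_space fun_scale by (rule vector_space_fun_scale)
  show ?thesis
    by unfold_locales (auto simp: fun_eq_iff fun_scale_def phi_eq_trace trace_row_outer
        algebra_simps sum.distrib sum_distrib_left)
qed

text \<open>Evaluating \<open>\<phi>\<^sub>a\<close> at the identity and at the transvections \<open>I + E\<^sub>j\<^sub>k\<close>
  recovers the products \<open>v\<^sub>j a\<^sub>k\<close>.\<close>

lemma inj_phi:
  fixes v :: "complex^'n"
  assumes "v \<noteq> 0" shows "inj (phi v)"
proof -
  interpret L: Vector_Spaces.linear "(*s)" fun_scale "phi v" by (rule linear_phi)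
  show ?thesis unfolding L.inj_iff_eq_0
  proof (intro allI impI)
    fix a assume "phi v a = 0"
    then have 0: "trace (row_outer a v ** A) = 0" if "det A = 1" for A
      using that by (metis phi_eq_trace mat_of_Abs_SL zero_fun_apply)
    obtain j where j: "v $ j \<noteq> 0" using assms by (auto simp: vec_eq_iff)
    have tr1: "trace (row_outer a v ** mat 1) = (\<Sum>i\<in>UNIV. v $ i * a $ i)"
      by (simp add: row_outer_def trace_def mult.commute)
    have off: "a $ k = 0" if "k \<noteq> j" for k
    proof -
      \<comment> \<open>Adding row \<open>k\<close> of the identity to row \<open>j\<close> keeps
        the determinant 1. Comparing with the value at the identity isolates
        \<open>v $ j * a $ k\<close>.\<close>
      define A :: "complex^'n^'n" where "A = (\<chi> i.
          if i = j then row j (mat 1) + 1 *s row k (mat 1) else row i (mat 1))"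
      have "A = mat 1 + (\<chi> i l. if i = j \<and> l = k then 1 else 0)"
        using that by (auto simp: A_def vec_eq_iff row_def mat_def)
      moreover have "trace (row_outer a v ** (\<chi> i l.
          if i = j \<and> l = k then 1 else 0)) = v $ j * a $ k"
      proof -
        have "(\<Sum>i\<in>UNIV. v $ l * (if l = j \<and> i = k then 1 else 0) * a $ i) =
            (if l = j then v $ j * a $ k else 0)" for l
          by (simp add: if_distrib[of "\<lambda>x. _ * x"] if_distrib[of "\<lambda>x. x * _"] cong: if_cong)
        then show ?thesis by (simp add: trace_row_outer)
      qed
      moreover have "det A = 1" unfolding A_def using that by (subst det_row_operation) auto
      ultimately have "v $ j * a $ k = 0"
        using 0[of A] 0[of "mat 1"] by (simp add: matrix_add_ldistrib trace_add)
      then show ?thesis using j by simp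
    qed
    \<comment> \<open>With the other coordinates of \<open>a\<close> gone, the value at the identity
      is \<open>v $ j * a $ j\<close>.\<close>
    have "(\<Sum>i\<in>UNIV. v $ i * a $ i) = (\<Sum>i\<in>{j}. v $ i * a $ i)"
      by (rule sum.mono_neutral_right) (auto simp: off)
    then have "v $ j * a $ j = 0" using 0[of "mat 1"] tr1 by simp
    then show "a = 0" using j off by (metis mult_eq_0_iff vec_eq_iff zero_index)
  qed
qed

theorem theorem8p3:
  fixes v :: "complex^'n"
  assumes "v \<noteq> 0"
  shows "module.subspace fun_scale (E_fam v) \<and>
    vector_space.dim fun_scale (E_fam v) = CARD('n) \<and>
    eigenfamily (E_fam v) \<and>
    (\<forall>\<phi>\<in>E_fam v. \<forall>\<psi>\<in>E_fam v. \<forall>p.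
       tau \<phi> p = - (2 * (of_nat CARD('n) ^ 2 - 1) / of_nat CARD('n)) * \<phi> p \<and>
       kappa \<phi> \<psi> p = - (2 * (of_nat CARD('n) - 1) / of_nat CARD('n)) * \<phi> p * \<psi> p)"
proof -
  interpret L: Vector_Spaces.linear "(*s)" fun_scale "phi v" by (rule linear_phi)
  \<comment> \<open>Only the domain is finite-dimensional in this locale; the space of all functions
    on the group is infinite-dimensional in general.\<close>
  interpret finite_dimensional_vector_space_pair_1 "(*s)" "cart_basis :: (complex^'n) set" fun_scale
    by (intro finite_dimensional_vector_space_pair_1.intro
        vec.finite_dimensional_vector_space_axioms vector_space_fun_scale)
  have E: "E_fam v = range (phi v)" by (auto simp: E_fam_def)
  have "module.subspace fun_scale (E_fam v)"
    unfolding E by (rule L.subspace_image) simp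
  moreover have "vector_space.dim fun_scale (E_fam v) = CARD('n)"
    unfolding E using dim_image_eq[OF linear_phi, of v UNIV] inj_phi[OF assms]
        by (simp add: card_cart_basis)
  moreover have "\<forall>\<phi>\<in>E_fam v. \<forall>\<psi>\<in>E_fam v. \<forall>p.
       tau \<phi> p = - (2 * (of_nat CARD('n) ^ 2 - 1) / of_nat CARD('n)) * \<phi> p \<and>
       kappa \<phi> \<psi> p = - (2 * (of_nat CARD('n) - 1) / of_nat CARD('n)) * \<phi> p * \<psi> p"
    by (auto simp only: E tau_phi kappa_phi)
  moreover from this have "eigenfamily (E_fam v)"
    unfolding eigenfamily_def using smooth_phi by (auto simp only: E)
  ultimately show ?thesis by blast
qed

end
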